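(* Let $q$ be a power of an odd prime, let $d\ge 2$ and $k\geq 1$ be integers, let $r\in \mathbb{F}_q$ be a nonzero square (i.e. $r=a^2$ for some $a\in\mathbb{F}_q$, $r\neq 0$), and let $A$ be a nonempty subset of $\{(i,j):1\leq i<j\leq k+1\}$. If $E\subset \mathbb{F}_q^d$ satisfies $\lvert E\rvert\geq 2kq^{d/2}$, then there exist $(x_1,\dots,x_{k+1})\in E^{k+1}$ and $(y_1,\dots,y_{k+1})\in E^{k+1}$ such that $\lVert y_i-y_j \rVert=r\lVert x_i-x_j \rVert$ for all $(i,j)\in A$, and $x_i\neq x_j$, $y_i\neq y_j$ for all $1\leq i<j\leq k+1$.
   Context: $\mathbb{F}_q$ denotes the finite field with $q$ elements and $\mathbb{F}_q^d$ the $d$-dimensional vector space over it. For $\alpha=(\alpha_1,\dots,\alpha_d)\in\mathbb{F}_q^d$, $\lVert \alpha\rVert:=\alpha_1^2+\dots+\alpha_d^2\in\mathbb{F}_q$. *)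

theory Defs
  imports Complex_Main "HOL-Analysis.Finite_Cartesian_Product" "HOL-Computational_Algebra.Primes"
begin

text \<open>The field-valued \<open>\<parallel>\<alpha>\<parallel> = \<alpha>\<^sub>1\<^sup>2 + \<dots> + \<alpha>\<^sub>d\<^sup>2\<close>: no square root is taken, and the value
  lies in the field itself, so this is unrelated to the library's real-valued \<open>norm\<close>.\<close>

definition sqnorm :: "'a::field ^ 'd \<Rightarrow> 'a" where
  "sqnorm v = (\<Sum>i\<in>UNIV. (v $ i)\<^sup>2)"

end

theory Submission imports Defs begin

text \<open>Write \<open>r = a\<^sup>2\<close>. Any map \<open>x \<mapsto> a x + z\<close> scales all squared distances by \<open>r\<close>, so it is enough
  to find a \<open>z\<close> for which this map sends at least \<open>k + 1\<close> points of \<open>E\<close> into \<open>E\<close>. Each pair in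
  \<open>E \<times> E\<close> determines exactly one \<open>z\<close>, so the average over \<open>z\<close> of the number of such points is
  \<open>|E|\<^sup>2 / q\<^sup>d \<ge> 4 k\<^sup>2 > k\<close>.\<close>

lemma sqnorm_vector_scalar_mult: "sqnorm (a *s v) = a\<^sup>2 * sqnorm v"
  by (simp add: sqnorm_def power_mult_distrib sum_distrib_left)

text \<open>Double counting: the left side counts pairs \<open>(z, x)\<close> with \<open>x\<close>
  in \<open>E\<close> and \<open>f x + z\<close> in \<open>F\<close>. Such a pair is recovered from
  \<open>(x, y)\<close> in \<open>E \<times> F\<close> by \<open>z = y - f x\<close>, for any map
  \<open>f\<close>.\<close>

lemma sum_card_translates:
  fixes E F :: "'v::{ab_group_add,finite} set"
  shows "(\<Sum>z\<in>UNIV. card {x \<in> E. f x + z \<in> F}) = card E * card F"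
proof -
  have "bij_betw (\<lambda>(z, x). (x, f x + z)) (SIGMA z:UNIV. {x \<in> E. f x + z \<in> F}) (E \<times> F)"
    by (rule bij_betwI[where g = "\<lambda>(x, y). (y - f x, x)"]) auto
  then have "card (SIGMA z:UNIV. {x \<in> E. f x + z \<in> F}) = card (E \<times> F)"
    by (rule bij_betw_same_card)
  then show ?thesis
    by (simp add: card_cartesian_product)
qed

text \<open>Pigeonhole: if every \<open>z\<close> gave at most \<open>k\<close> points, the total
  \<open>card E * card F\<close> would be at most \<open>k * CARD('v)\<close>.\<close>

lemma exists_translate_card_gt:
  fixes E F :: "'v::{ab_group_add,finite} set"
  assumes "k * CARD('v) < card E * card F"
  obtains z where "k < card {x \<in> E. f x + z \<in> F}"
proof (rule ccontr)
  assume "\<not> thesis"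
  then have "card {x \<in> E. f x + z \<in> F} \<le> k" for z
    using that not_le by blast
  then have "(\<Sum>z\<in>UNIV. card {x \<in> E. f x + z \<in> F}) \<le> k * CARD('v)"
    using sum_bounded_above[of UNIV "\<lambda>z. card {x \<in> E. f x + z \<in> F}" k] by (simp add: mult.commute)
  with assms show False
    by (simp add: sum_card_translates)
qed

theorem theorem1p3:
  fixes E :: "('a::{field,finite} ^ 'd) set"
    and r :: 'a
    and A :: "(nat \<times> nat) set"
    and p n q d k :: nat
  assumes "prime p" and "odd p" and "n \<ge> 1" and "q = p ^ n" and "CARD('a) = q"
    and "CARD('d) = d" and "d \<ge> 2"
    and "k \<ge> 1"
    and "r \<noteq> 0" and "\<exists>a. r = a\<^sup>2"
    and "A \<noteq> {}" and "A \<subseteq> {(i, j). 1 \<le> i \<and> i < j \<and> j \<le> k + 1}"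
    and "real (card E) \<ge> 2 * real k * real q powr (real d / 2)"
  shows "\<exists>x y :: nat \<Rightarrow> 'a ^ 'd.
           (\<forall>i\<in>{1..k+1}. x i \<in> E) \<and> (\<forall>i\<in>{1..k+1}. y i \<in> E) \<and>
           (\<forall>(i, j)\<in>A. sqnorm (y i - y j) = r * sqnorm (x i - x j)) \<and>
           (\<forall>i j. 1 \<le> i \<and> i < j \<and> j \<le> k + 1 \<longrightarrow> x i \<noteq> x j \<and> y i \<noteq> y j)"
proof -
  obtain a where a: "r = a\<^sup>2" "a \<noteq> 0"
    using assms(9,10) by auto
  have "q > 0"
    using assms(1,4) by (simp add: prime_gt_0_nat)
  \<comment> \<open>Squaring removes the possibly half-integral exponent, so the size hypothesis
    becomes an inequality between natural numbers.\<close>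
  have "(real q powr (real d / 2))\<^sup>2 = real q ^ d"
    using \<open>q > 0\<close> by (simp add: power2_eq_square powr_add[symmetric] powr_realpow)
  then have "4 * (real k)\<^sup>2 * real q ^ d = (2 * real k * real q powr (real d / 2))\<^sup>2"
    by (simp add: power_mult_distrib)
  also have "\<dots> \<le> (real (card E))\<^sup>2"
    using assms(13) by (intro power_mono) auto
  finally have "real (4 * k\<^sup>2 * q ^ d) \<le> real (card E * card E)"
    by (simp add: power2_eq_square)
  then have "4 * k\<^sup>2 * q ^ d \<le> card E * card E"
    by (simp only: of_nat_le_iff)
  \<comment> \<open>Strict because \<open>k \<ge> 1\<close> gives
    \<open>k < 4 * k\<^sup>2\<close>.\<close>
  moreover have "k * q ^ d < 4 * k\<^sup>2 * q ^ d"
    using \<open>q > 0\<close> assms(8) by (simp add: power2_eq_square)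
  ultimately have "k * q ^ d < card E * card E"
    by (rule less_le_trans[rotated])
  then have "k * CARD('a ^ 'd) < card E * card E"
    using assms(5,6) by simp
  then obtain z where "k < card {x \<in> E. a *s x + z \<in> E}"
    by (rule exists_translate_card_gt)
  then have "k + 1 \<le> card {x \<in> E. a *s x + z \<in> E}"
    by simp
  \<comment> \<open>Trimming to exactly \<open>k + 1\<close> points lets a bijection from
    \<open>{1..k+1}\<close> list them as distinct \<open>x i\<close>.\<close>
  then obtain S where S: "S \<subseteq> {x \<in> E. a *s x + z \<in> E}" "card S = k + 1" "finite S"
    by (rule obtain_subset_with_card_n)
  then obtain x where x: "bij_betw x {1..k+1} S"
    using finite_same_card_bij[of "{1..k+1}" S] by auto
  define y where "y i = a *s x i + z" for i
  have mem: "x i \<in> E \<and> y i \<in> E" if "i \<in> {1..k+1}" for i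
    using bij_betwE[OF x] S(1) that unfolding y_def by blast
  \<comment> \<open>The shift \<open>z\<close> cancels, so squared distances scale by
    \<open>a\<^sup>2 = r\<close>.\<close>
  have diff: "y i - y j = a *s (x i - x j)" for i j
    by (simp add: y_def vec_eq_iff right_diff_distrib)
  have "x i \<noteq> x j" if "1 \<le> i" "i < j" "j \<le> k + 1" for i j
    using bij_betw_imp_inj_on[OF x] that by (simp add: inj_on_eq_iff)
  \<comment> \<open>Since \<open>a \<noteq> 0\<close>, the map \<open>x \<mapsto> a *s x + z\<close>
    is injective.\<close>
  moreover have "y i \<noteq> y j" if "x i \<noteq> x j" for i j
    using that a(2) by (simp add: y_def vec_eq_iff)
  ultimately have "\<forall>i j. 1 \<le> i \<and> i < j \<and> j \<le> k + 1 \<longrightarrow> x i \<noteq> x j \<and> y i \<noteq> y j"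
    by blast
  moreover have "\<forall>(i, j)\<in>A. sqnorm (y i - y j) = r * sqnorm (x i - x j)"
    by (simp add: diff sqnorm_vector_scalar_mult a(1))
  ultimately show ?thesis
    using mem by blast
qed

end
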